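(* Consider a sequence $\mu^\varepsilon\in C([0,T];\mathcal P(\mathcal X))$ of solutions to $\partial_t\mu^\varepsilon=(L^\varepsilon)^T\mu^\varepsilon$ with initial data $\mu^\varepsilon|_{t=0}=\mu^\varepsilon_0\in\mathcal P(\mathcal X)$. Assume that $$\sup_{\varepsilon>0}\mathscr H(\mu^\varepsilon_0|\pi^\varepsilon)<\infty.$$ Then, along a subsequence $\varepsilon\to0$ (not relabelled): 1. (Compactness) There is $\mu\in\mathcal M([0,T]\times\mathcal X)$ such that $\mu^\varepsilon\to\mu$ in $\mathcal M([0,T]\times\mathcal X)$ with respect to the narrow topology, and $\xi_\#\mu^\varepsilon\to\xi_\#\mu$ in $C([0,T];\mathcal P(\mathcal Y))$ uniformly in time. 2. (Local equilibrium) There exists $\hat\mu\in C([0,T];\mathcal P(\mathcal Y))$ such that for almost all $t\in[0,T]$ $$\forall y\in\mathcal Y,\ A\subset\mathcal Z:\quad\mu_t(\{y\}\times A)=\hat\mu_t(y)\,\pi_y(A),$$ where for each $y\in\mathcal Y$, $\pi_y\in\mathcal P(\mathcal Z)$ is the stationary measure corresponding to $Q_y$. Furthermore $\xi_\#\mu^\varepsilon\to\hat\mu$ in $C([0,T];\mathcal P(\mathcal Y))$ uniformly in time. 3. (Limit dynamics) The limit $\hat\mu\in C([0,T];\mathcal P(\mathcal Y))$ solves $\partial_t\hat\mu=L^T\hat\mu$ with the generator $$L:=\begin{pmatrix}-\lambda_0&\lambda_0\\ \lambda_1&-\lambda_1\end{pmatrix},\qquad\lambda_y:=\sum_{z,z'\in\mathcal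 Z}\pi_y(z)\,C_{y,1-y}(z,z').$$
   Context: $T>0$, $n\in\mathbb N$, $\mathcal Y=\{0,1\}$, $\mathcal Z=\{1,\dots,n\}$, $\mathcal X=\mathcal Y\times\mathcal Z$. For $\varepsilon>0$, $$L^\varepsilon=\frac1\varepsilon Q+C,\qquad Q=\begin{pmatrix}Q_0&0\\0&Q_1\end{pmatrix},\qquad C=\begin{pmatrix}D_0&C_{0,1}\\C_{1,0}&D_1\end{pmatrix},$$ where $Q,C$ do not depend on $\varepsilon$ and the blocks are indexed by $\mathcal Y$ and act on $\mathcal Z$. Each $Q_y\in\mathbb R^{n\times n}$ has non-negative off-diagonal entries, zero row sums, and is irreducible; each $C_{y,1-y}\in\mathbb R^{n\times n}$ has non-negative entries; $D_y$ is the diagonal matrix with $D_y(z,z)=-\sum_{z'\in\mathcal Z}C_{y,1-y}(z,z')$. Thus $\sum_{x'}Q(x,x')=0=\sum_{x'}C(x,x')$ for all $x\in\mathcal X$. $L^\varepsilon$ is assumed irreducible (equivalently, $C_{0,1}$ and $C_{1,0}$ each have at least one positive entry). $\pi^\varepsilon\in\mathcal P(\mathcal X)$ is the stationary measure, $(L^\varepsilon)^T\pi^\varepsilon=0$. $\mathcal P(\cdot)$ denotes probability measures (subsets of finite-dimensional spaces with the usual topology). $\mathcal M([0,T]\times\mathcal X)$ is the space of non-negative finite measures on $[0,T]\times\mathcal X$; a curve $t\mapsto\mu_t\in\mathcal P(\mathcal X)$ is identified with the measure $\mu_t(dx)\,dt$ on $[0,T]\times\mathcal X$, and the limit $\mu$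 is likewise disintegrated as $\mu=\int_0^T\mu_t\,dt$ with a Borel family $(\mu_t)$. The coarse-graining map is $\xi:\mathcal X\to\mathcal Y$, $\xi(y,z)=y$; $\xi_\#\mu$ denotes the curve $t\mapsto\xi_\#\mu_t$ of push-forwards. Relative entropy: $\mathscr H(\mu|\rho)=\sum_{x}f(x)\log f(x)\,\rho(x)$ if $\mu\ll\rho$ with $f=d\mu/d\rho$ (with $0\log0=0$), and $+\infty$ otherwise. *)

theory Defs
  imports "HOL-Analysis.Analysis"
begin

(* Conventions.
   Y = {0,1} is the two-element type 2 of HOL-Library.Numeral_Type, where 1 - y is the
   element of Y other than y.  Z = {1,...,n} is an arbitrary finite type 'z, n = CARD('z).
   Measures on a finite type 'x are vectors in real^'x, with the Euclidean topology. *)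

section \<open>Probability vectors\<close>

definition prob_vectors :: "(real ^ 'x) set" where
  "prob_vectors = {p. (\<forall>x. 0 \<le> p $ x) \<and> (\<Sum>x\<in>UNIV. p $ x) = 1}"

definition mass :: "real ^ 'x \<Rightarrow> 'x set \<Rightarrow> real" where
  "mass p A = (\<Sum>x\<in>A. p $ x)"

definition push_forward :: "('x \<Rightarrow> 'y) \<Rightarrow> real ^ 'x \<Rightarrow> real ^ 'y" where
  "push_forward f p = (\<chi> y. mass p (f -` {y}))"

definition coarse :: "2 \<times> 'z \<Rightarrow> 2" where
  "coarse = fst"

definition relative_entropy :: "real ^ 'x \<Rightarrow> real ^ 'x \<Rightarrow> ereal" where
  "relative_entropy \<mu> \<rho> =
     (if \<forall>x. \<rho> $ x = 0 \<longrightarrow> \<mu> $ x = 0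
      then ereal (\<Sum>x\<in>UNIV. let f = \<mu> $ x / \<rho> $ x in f * ln f * \<rho> $ x)
      else \<infinity>)"


section \<open>Generators\<close>

(* Every index is reachable from every other one along nonzero entries.  The diagonal plays
   no role, and for nonnegative off-diagonal entries nonzero means positive there. *)
definition irreducible_matrix :: "real ^ 'x ^ 'x \<Rightarrow> bool" where
  "irreducible_matrix A \<longleftrightarrow> (\<forall>x y. (x, y) \<in> {(x, y). A $ x $ y \<noteq> 0}\<^sup>*)"

definition is_generator :: "real ^ 'x ^ 'x \<Rightarrow> bool" where
  "is_generator A \<longleftrightarrow>
     (\<forall>x y. x \<noteq> y \<longrightarrow> 0 \<le> A $ x $ y) \<and> (\<forall>x. (\<Sum>y\<in>UNIV. A $ x $ y) = 0)"

definition stationary :: "real ^ 'x ^ 'x \<Rightarrow> real ^ 'x \<Rightarrow> bool" where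
  "stationary A p \<longleftrightarrow> p \<in> prob_vectors \<and> transpose A *v p = 0"

definition block_matrix :: "(2 \<Rightarrow> 2 \<Rightarrow> real ^ 'z ^ 'z) \<Rightarrow> real ^ (2 \<times> 'z) ^ (2 \<times> 'z)" where
  "block_matrix B = (\<chi> x x'. B (fst x) (fst x') $ snd x $ snd x')"

definition diag_block :: "(2 \<Rightarrow> 2 \<Rightarrow> real ^ 'z ^ 'z) \<Rightarrow> 2 \<Rightarrow> real ^ 'z ^ 'z" where
  "diag_block C y =
     (\<chi> z z'. if z = z' then - (\<Sum>z''\<in>UNIV. C y (1 - y) $ z $ z'') else 0)"

definition fast_matrix :: "(2 \<Rightarrow> real ^ 'z ^ 'z) \<Rightarrow> real ^ (2 \<times> 'z) ^ (2 \<times> 'z)" where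
  "fast_matrix Q = block_matrix (\<lambda>y y'. if y = y' then Q y else 0)"

(* Only the blocks C y (1 - y) of the argument are used. *)
definition slow_matrix :: "(2 \<Rightarrow> 2 \<Rightarrow> real ^ 'z ^ 'z) \<Rightarrow> real ^ (2 \<times> 'z) ^ (2 \<times> 'z)" where
  "slow_matrix C = block_matrix (\<lambda>y y'. if y = y' then diag_block C y else C y y')"

definition two_scale_generator ::
  "(2 \<Rightarrow> real ^ 'z ^ 'z) \<Rightarrow> (2 \<Rightarrow> 2 \<Rightarrow> real ^ 'z ^ 'z) \<Rightarrow> real \<Rightarrow> real ^ (2 \<times> 'z) ^ (2 \<times> 'z)"
  where "two_scale_generator Q C \<epsilon> = (1 / \<epsilon>) *\<^sub>R fast_matrix Q + slow_matrix C"

definition averaged_rate ::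
  "(2 \<Rightarrow> 2 \<Rightarrow> real ^ 'z ^ 'z) \<Rightarrow> (2 \<Rightarrow> real ^ 'z) \<Rightarrow> 2 \<Rightarrow> real" where
  "averaged_rate C \<pi> y = (\<Sum>z\<in>UNIV. \<Sum>z'\<in>UNIV. \<pi> y $ z * C y (1 - y) $ z $ z')"

definition limit_generator ::
  "(2 \<Rightarrow> 2 \<Rightarrow> real ^ 'z ^ 'z) \<Rightarrow> (2 \<Rightarrow> real ^ 'z) \<Rightarrow> real ^ 2 ^ 2" where
  "limit_generator C \<pi> =
     (\<chi> y y'. if y = y' then - averaged_rate C \<pi> y else averaged_rate C \<pi> y)"


section \<open>Curves and measures on time-space\<close>

definition prob_curve :: "real \<Rightarrow> (real \<Rightarrow> real ^ 'x) \<Rightarrow> bool" where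
  "prob_curve T \<mu> \<longleftrightarrow> continuous_on {0..T} \<mu> \<and> \<mu> ` {0..T} \<subseteq> prob_vectors"

(* One-sided derivatives at the endpoints 0 and T. *)
definition solves_forward :: "real \<Rightarrow> real ^ 'x ^ 'x \<Rightarrow> (real \<Rightarrow> real ^ 'x) \<Rightarrow> bool" where
  "solves_forward T A \<mu> \<longleftrightarrow>
     (\<forall>t\<in>{0..T}. (\<mu> has_vector_derivative transpose A *v \<mu> t) (at t within {0..T}))"

definition time_space_measures :: "real \<Rightarrow> (real \<times> 'x) measure set" where
  "time_space_measures T =
     {M. sets M = sets (restrict_space borel {0..T} \<Otimes>\<^sub>M count_space UNIV) \<and> finite_measure M}"

definition borel_family :: "real \<Rightarrow> (real \<Rightarrow> real ^ 'x) \<Rightarrow> bool" where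
  "borel_family T \<mu> \<longleftrightarrow>
     \<mu> \<in> borel_measurable (restrict_space borel {0..T}) \<and> \<mu> ` {0..T} \<subseteq> prob_vectors"

(* The measure mu_t(dx) dt. *)
definition curve_measure :: "real \<Rightarrow> (real \<Rightarrow> real ^ 'x) \<Rightarrow> (real \<times> 'x) measure" where
  "curve_measure T \<mu> =
     density (restrict_space lborel {0..T} \<Otimes>\<^sub>M count_space UNIV)
       (\<lambda>(t, x). ennreal (\<mu> t $ x))"

definition narrowly_converges ::
  "real \<Rightarrow> (nat \<Rightarrow> (real \<times> 'x) measure) \<Rightarrow> (real \<times> 'x) measure \<Rightarrow> bool" where
  "narrowly_converges T Ms M \<longleftrightarrow>
     (\<forall>\<phi> :: real \<times> 'x \<Rightarrow> real.
        continuous_map (prod_topology (top_of_set {0..T}) (discrete_topology UNIV)) euclideanreal \<phi> \<and>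
        bounded (\<phi> ` ({0..T} \<times> UNIV)) \<longrightarrow>
        (\<lambda>k. integral\<^sup>L (Ms k) \<phi>) \<longlonglongrightarrow> integral\<^sup>L M \<phi>)"

end

theory Submission
  imports Defs
begin

text \<open>
  The proof rests on the averaging principle, in the form of perturbed test functions.
  Let \<open>\<mu>\<close> solve the forward equation of \<open>(1 / \<epsilon>) Q + C\<close> and let \<open>H\<close> be any observable.  Then \<open>\<mu> \<bullet> H\<close> has derivative
  \<open>(1 / \<epsilon>) \<mu> \<bullet> (Q H) + \<mu> \<bullet> (C H)\<close>, so \<open>\<mu> \<bullet> (Q H)\<close> is \<open>\<epsilon>\<close> times the derivative of a bounded
  function plus a bounded multiple of \<open>\<epsilon>\<close>: the fast oscillations of any observable in the range
  of \<open>Q\<close> cancel when integrated in time.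

  By irreducibility, the Poisson equation on each fibre can be solved (lemma \<open>poisson_equation\<close>).
  Every observable is thus the sum of its average against the equilibria \<open>\<pi> y\<close>, which is a function
  of the coarse state, and of some \<open>Q H\<close> (lemma \<open>fast_decomposition\<close>).  This decomposition is used
  twice.

  Firstly, functions of the coarse state are annihilated by \<open>Q\<close>, so the coarse-grained curve is
  driven by \<open>C\<close> alone.  Decomposing the driving term and absorbing its fast part into a corrector of
  order \<open>\<epsilon>\<close> shows that the curve solves the two-state limit equation up to order \<open>\<epsilon>\<close>, uniformly in
  time (lemma \<open>coarse_curve_estimate\<close>).  As this equation has a unique solution for given
  initial data, compactness of the set of initial values is all the compactness that is called for.

  Secondly, decomposing the indicator of a single state shows that its mass, integrated in time
  against a continuous weight, converges to the same integral for the local equilibrium built from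
  the limit of the coarse-grained curves (lemmas \<open>fast_observable_averages_out\<close> and
  \<open>narrow_convergence_to_local_equilibrium\<close>).  The limit measure is therefore a continuous curve
  which is in local equilibrium at every time.
\<close>

section \<open>Probability vectors and push-forwards\<close>

lemma prob_vectors_norm_le: "p \<in> prob_vectors \<Longrightarrow> norm p \<le> 1"
  using norm_le_l1_cart[of p] by (simp add: prob_vectors_def)

lemma prob_vectors_inner_le:
  assumes "p \<in> prob_vectors"
  shows "\<bar>p \<bullet> v\<bar> \<le> norm v"
  using Cauchy_Schwarz_ineq2[of p v] mult_right_mono[OF prob_vectors_norm_le[OF assms], of "norm v"]
  by simp

lemma compact_prob_vectors: "compact (prob_vectors :: (real ^ 'x) set)"
proof -
  have "closed ((\<Inter>x. {p. 0 \<le> p $ x}) \<inter> {p :: real ^ 'x. (\<Sum>x\<in>UNIV. p $ x) = 1})"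
    by (intro closed_Int closed_INT ballI closed_Collect_le closed_Collect_eq continuous_intros)
  moreover have "(\<Inter>x. {p. 0 \<le> p $ x}) \<inter> {p :: real ^ 'x. (\<Sum>x\<in>UNIV. p $ x) = 1} = prob_vectors"
    by (auto simp: prob_vectors_def)
  ultimately show ?thesis
    using prob_vectors_norm_le by (auto simp: compact_eq_bounded_closed bounded_iff)
qed

definition pull_back :: "('x \<Rightarrow> 'y) \<Rightarrow> real ^ 'y \<Rightarrow> real ^ 'x" where
  "pull_back f g = (\<chi> x. g $ f x)"

text \<open>
  Pulling observables back is adjoint to pushing measures forward.  This is how the evolution of
  the coarse-grained curve is read off from observables on the fine state space.
\<close>
lemma inner_pull_back: "p \<bullet> pull_back f g = push_forward f p \<bullet> g"
proof -
  have "(\<Sum>y\<in>UNIV. push_forward f p $ y * g $ y) =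
      (\<Sum>y\<in>UNIV. \<Sum>x | x \<in> UNIV \<and> f x = y. p $ x * g $ f x)"
    by (intro sum.cong) (auto simp: push_forward_def mass_def sum_distrib_right vimage_def)
  also have "\<dots> = (\<Sum>x\<in>UNIV. p $ x * g $ f x)"
    by (rule sum.group) auto
  finally show ?thesis
    by (simp add: inner_vec_def pull_back_def)
qed

lemma push_forward_prob_vectors:
  assumes "p \<in> prob_vectors"
  shows "push_forward f p \<in> prob_vectors"
proof -
  have "p \<bullet> pull_back f 1 = push_forward f p \<bullet> 1"
    by (rule inner_pull_back)
  then have "(\<Sum>y\<in>UNIV. push_forward f p $ y) = 1"
    using assms by (simp add: inner_vec_def pull_back_def prob_vectors_def)
  moreover have "0 \<le> push_forward f p $ y" for y
    using assms by (simp add: push_forward_def mass_def prob_vectors_def sum_nonneg)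
  ultimately show ?thesis
    by (simp add: prob_vectors_def)
qed

section \<open>The Poisson equation of an irreducible generator\<close>

text \<open>
  The discrete maximum principle.  At a state where \<open>h\<close> is maximal, \<open>A h = 0\<close> says that a sum
  of non-negative terms \<open>A a c (m - h c)\<close> vanishes, so every neighbour is a maximiser as well;
  irreducibility carries this to all states.
\<close>
lemma generator_harmonic_constant:
  assumes gen: "is_generator A" and irr: "irreducible_matrix A" and h: "A *v h = 0"
  shows "h $ x = h $ y"
proof -
  define m where "m = Max (range (($) h))"
  have le_m: "h $ x \<le> m" for x
    by (simp add: m_def)
  have "m \<in> range (($) h)"
    unfolding m_def by (rule Max_in) auto
  then obtain x0 where x0: "h $ x0 = m"
    by auto
  have step: "h $ b = m" if a: "h $ a = m" and ab: "A $ a $ b \<noteq> 0" for a b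
  proof (cases "a = b")
    case False
    have "(\<Sum>c\<in>UNIV. A $ a $ c * h $ c) = 0"
      using h by (simp add: matrix_vector_mult_def vec_eq_iff)
    moreover have "(\<Sum>c\<in>UNIV. A $ a $ c * m) = 0"
      using gen by (simp add: is_generator_def flip: sum_distrib_right)
    ultimately have sum0: "(\<Sum>c\<in>UNIV. A $ a $ c * (m - h $ c)) = 0"
      by (simp add: right_diff_distrib sum_subtractf)
    have "0 \<le> A $ a $ c * (m - h $ c)" for c
      using gen le_m[of c] a by (cases "c = a") (auto simp: is_generator_def)
    then have "A $ a $ b * (m - h $ b) = 0"
      using sum0 by (simp add: sum_nonneg_eq_0_iff)
    then show ?thesis
      using ab by simp
  qed (use a in simp)
  have "h $ b = m" for b
  proof -
    have "(x0, b) \<in> {(x, y). A $ x $ y \<noteq> 0}\<^sup>*"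
      using irr by (simp add: irreducible_matrix_def)
    then show ?thesis
      by induction (use x0 step in auto)
  qed
  then show ?thesis
    by simp
qed

text \<open>
  Every observable is, up to its mean under the stationary measure, in the range of the generator.
  The rank-one perturbation \<open>h \<mapsto> A h + (p \<bullet> h) 1\<close> has trivial kernel: pairing with \<open>p\<close> kills
  \<open>A h\<close> and leaves \<open>p \<bullet> h\<close>, so a kernel element is harmonic with mean zero, that is, zero.
  Being injective, the perturbation is onto.
\<close>
lemma poisson_equation:
  fixes A :: "real ^ 'x ^ 'x"
  assumes gen: "is_generator A" and irr: "irreducible_matrix A" and st: "stationary A p"
  obtains h where "\<And>x. f $ x = p \<bullet> f + (A *v h) $ x"
proof -
  define S where "S h = A *v h + (p \<bullet> h) *\<^sub>R 1" for h
  have p1: "p \<bullet> 1 = 1"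
    using st by (simp add: stationary_def prob_vectors_def inner_vec_def)
  have pA: "p \<bullet> (A *v h) = 0" for h
    using st by (simp add: stationary_def flip: dot_lmul_matrix)
  have pS: "p \<bullet> S h = p \<bullet> h" for h
    by (simp add: S_def inner_add_right pA p1)
  have lin: "linear S"
    unfolding S_def
    by (intro linearI) (auto simp: matrix_vector_right_distrib inner_add_right
        scaleR_add_left scaleR_add_right matrix_vector_mult_scaleR)
  have "h = 0" if "S h = 0" for h
  proof -
    have ph: "p \<bullet> h = 0"
      using pS[of h] that by simp
    then have "A *v h = 0"
      using that by (simp add: S_def)
    then have "h $ x = h $ y" for x y
      using generator_harmonic_constant[OF gen irr] by blast
    then obtain c where c: "\<And>x. h $ x = c"
      by metis
    then have "h = c *\<^sub>R 1"
      by (simp add: vec_eq_iff)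
    with ph p1 show ?thesis
      by simp
  qed
  then have "inj S"
    using lin by (simp add: linear_injective_0)
  then have "surj S"
    using linear_injective_imp_surjective[OF lin _ refl] by blast
  then obtain h where h: "f = S h"
    by (auto simp: surj_def)
  then have "f $ x = p \<bullet> f + (A *v h) $ x" for x
    using pS[of h] by (simp add: S_def)
  then show ?thesis
    by (rule that)
qed

section \<open>Splitting an observable into its local average and a fast part\<close>

definition fibre :: "real ^ (2 \<times> 'z) \<Rightarrow> 2 \<Rightarrow> real ^ 'z" where
  "fibre G y = (\<chi> z. G $ (y, z))"

definition local_average :: "(2 \<Rightarrow> real ^ 'z) \<Rightarrow> real ^ (2 \<times> 'z) \<Rightarrow> real ^ 2" where
  "local_average \<pi> G = (\<chi> y. \<pi> y \<bullet> fibre G y)"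

lemma sum_two_blocks:
  "(\<Sum>x\<in>UNIV. g x) = (\<Sum>y\<in>UNIV. \<Sum>z\<in>UNIV. g (y, z))"
  for g :: "2 \<times> 'z::finite \<Rightarrow> real"
  by (simp add: sum.cartesian_product)

text \<open>
  In arithmetic modulo 2 the states are \<open>y\<close> and \<open>1 - y\<close>, whichever \<open>y\<close> is singled out; this keeps
  all computations symmetric in the two states.
\<close>
lemma sum_two_states: "(\<Sum>y'\<in>UNIV. f y') = f y + f (1 - y)" for f :: "2 \<Rightarrow> real"
proof -
  have "(1 :: 2) - 1 = 2" "(1 :: 2) - 2 = 1"
    by simp_all
  then show ?thesis
    using exhaust_2[of y] unfolding sum_2 by (metis add.commute)
qed

lemma two_states_neq [simp]: "1 - y \<noteq> y" "y \<noteq> 1 - y" for y :: 2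
  using exhaust_2[of y] by auto

lemma fibre_fast_matrix: "fibre (fast_matrix Q *v H) y = Q y *v fibre H y"
  by (simp add: vec_eq_iff fibre_def matrix_vector_mult_def sum_two_blocks
      sum_two_states[of _ y] fast_matrix_def block_matrix_def)

text \<open>
  The Poisson equation, solved on each fibre \<open>{y} \<times> Z\<close> separately.  The first part only depends on
  the coarse state; the second lies in the range of the fast generator, and such observables
  average out along the dynamics.
\<close>
lemma fast_decomposition:
  fixes G :: "real ^ (2 \<times> 'z::finite)"
  assumes "\<And>y. is_generator (Q y)" "\<And>y. irreducible_matrix (Q y)" "\<And>y. stationary (Q y) (\<pi> y)"
  obtains H where "G = pull_back coarse (local_average \<pi> G) + fast_matrix Q *v H"
proof -
  have "\<exists>h. \<forall>z. fibre G y $ z = \<pi> y \<bullet> fibre G y + (Q y *v h) $ z" for y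
    using poisson_equation[OF assms(1-3)[of y], where f = "fibre G y"] by metis
  then obtain h where h: "\<And>y z. fibre G y $ z = \<pi> y \<bullet> fibre G y + (Q y *v h y) $ z"
    by metis
  define H where "H = (\<chi> x. h (fst x) $ snd x)"
  have H: "fibre H y = h y" for y
    by (simp add: fibre_def H_def vec_eq_iff)
  have "G $ (y, z) = (pull_back coarse (local_average \<pi> G) + fast_matrix Q *v H) $ (y, z)" for y z
    using h[of y z] fibre_fast_matrix[of Q H y]
    by (simp add: pull_back_def local_average_def coarse_def H)
      (simp add: fibre_def vec_eq_iff)
  then show ?thesis
    by (intro that[of H]) (simp add: vec_eq_iff)
qed

lemma fast_matrix_pull_back:
  assumes "\<And>y. is_generator (Q y)"
  shows "fast_matrix Q *v pull_back coarse g = 0"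
proof -
  have "fibre (fast_matrix Q *v pull_back coarse g) y $ z = 0" for y z
    using assms[of y] unfolding fibre_fast_matrix
    by (simp add: fibre_def pull_back_def coarse_def matrix_vector_mult_def is_generator_def
        flip: sum_distrib_right)
  then show ?thesis
    by (simp add: fibre_def vec_eq_iff)
qed

lemma slow_matrix_pull_back:
  "(slow_matrix C *v pull_back coarse g) $ (y, z) =
    (\<Sum>z'\<in>UNIV. C y (1 - y) $ z $ z') * (g $ (1 - y) - g $ y)"
  by (simp add: matrix_vector_mult_def sum_two_blocks sum_two_states[of _ y] slow_matrix_def
      block_matrix_def diag_block_def pull_back_def coarse_def if_distrib[of "\<lambda>x. x * _"]
      right_diff_distrib cong: if_cong flip: sum_distrib_right)

lemma limit_generator_mult:
  "(limit_generator C \<pi> *v g) $ y = averaged_rate C \<pi> y * (g $ (1 - y) - g $ y)"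
  by (simp add: matrix_vector_mult_def limit_generator_def sum_two_states[of _ y]
      right_diff_distrib)

text \<open>
  The limit generator is the slow generator acting on functions of the coarse state, averaged
  over the fibres against the equilibria \<open>\<pi> y\<close>.
\<close>
lemma local_average_slow_matrix:
  "local_average \<pi> (slow_matrix C *v pull_back coarse g) = limit_generator C \<pi> *v g"
proof -
  have "local_average \<pi> (slow_matrix C *v pull_back coarse g) $ y =
      averaged_rate C \<pi> y * (g $ (1 - y) - g $ y)" for y
    by (simp add: local_average_def fibre_def inner_vec_def slow_matrix_pull_back
        averaged_rate_def sum_distrib_left sum_distrib_right mult.assoc)
  then show ?thesis
    by (simp add: vec_eq_iff limit_generator_mult)
qed

section \<open>Observables along the two-scale dynamics\<close>

lemma solves_forward_observable:
  assumes "solves_forward T A \<mu>" and "t \<in> {0..T}"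
  shows "((\<lambda>t. \<mu> t \<bullet> v) has_real_derivative \<mu> t \<bullet> (A *v v)) (at t within {0..T})"
proof -
  have "((\<lambda>t. \<mu> t \<bullet> v) has_vector_derivative (transpose A *v \<mu> t) \<bullet> v) (at t within {0..T})"
    using assms by (intro bounded_linear.has_vector_derivative[OF bounded_linear_inner_left])
      (auto simp: solves_forward_def)
  then show ?thesis
    by (simp add: has_real_derivative_iff_has_vector_derivative dot_lmul_matrix)
qed

lemma two_scale_generator_mult:
  "two_scale_generator Q C \<epsilon> *v v = (1 / \<epsilon>) *\<^sub>R (fast_matrix Q *v v) + slow_matrix C *v v"
  by (simp add: two_scale_generator_def matrix_vector_mult_add_rdistrib
      scaleR_matrix_vector_assoc)

lemma two_scale_observable:
  assumes "solves_forward T (two_scale_generator Q C \<epsilon>) \<mu>" and "t \<in> {0..T}"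
  shows "((\<lambda>t. \<mu> t \<bullet> v) has_real_derivative
      \<mu> t \<bullet> (fast_matrix Q *v v) / \<epsilon> + \<mu> t \<bullet> (slow_matrix C *v v)) (at t within {0..T})"
  using solves_forward_observable[OF assms, of v]
  by (simp add: two_scale_generator_mult inner_add_right)

lemma prob_curve_observable:
  assumes "prob_curve T \<mu>"
  shows "continuous_on {0..T} (\<lambda>t. \<mu> t \<bullet> v)"
    and "t \<in> {0..T} \<Longrightarrow> \<bar>\<mu> t \<bullet> v\<bar> \<le> norm v"
  using assms by (auto simp: prob_curve_def intro!: continuous_intros prob_vectors_inner_le)

section \<open>Time averages of fast observables vanish\<close>

text \<open>
  Along a solution, \<open>\<mu> \<bullet> (Q H)\<close> is \<open>\<epsilon>\<close> times the time derivative of \<open>\<mu> \<bullet> H\<close>, minus \<open>\<epsilon>\<close> times the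
  bounded function \<open>\<mu> \<bullet> (C H)\<close>, where \<open>Q\<close> and \<open>C\<close> are the fast and slow parts.  Integrating the
  derivative by parts against a smooth weight therefore leaves only terms of order \<open>\<epsilon>\<close>.
\<close>
lemma fast_observable_smooth_bound:
  fixes p :: "real \<Rightarrow> real"
  assumes T: "0 \<le> T" and eps: "0 < \<epsilon>"
    and curve: "prob_curve T \<mu>" and sol: "solves_forward T (two_scale_generator Q C \<epsilon>) \<mu>"
    and p: "\<And>t. t \<in> {0..T} \<Longrightarrow> (p has_real_derivative p' t) (at t within {0..T})"
    and p': "continuous_on {0..T} p'"
    and B: "\<And>t. t \<in> {0..T} \<Longrightarrow> \<bar>p t\<bar> \<le> B" "\<And>t. t \<in> {0..T} \<Longrightarrow> \<bar>p' t\<bar> \<le> B"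
  shows "\<bar>integral {0..T} (\<lambda>t. p t * (\<mu> t \<bullet> (fast_matrix Q *v H)))\<bar>
    \<le> \<epsilon> * (B * (2 * norm H + T * (norm H + norm (slow_matrix C *v H))))"
proof -
  let ?q = "\<lambda>t. \<mu> t \<bullet> (fast_matrix Q *v H)"
  let ?c = "\<lambda>t. \<mu> t \<bullet> (slow_matrix C *v H)"
  let ?r = "\<lambda>t. p' t * (\<mu> t \<bullet> H) + p t * ?c t"
  let ?b = "p T * (\<mu> T \<bullet> H) - p 0 * (\<mu> 0 \<bullet> H)"
  note obs = prob_curve_observable[OF curve]
  have pc: "continuous_on {0..T} p"
    using p by (rule DERIV_continuous_on)
  have "((\<lambda>t. p t * (\<mu> t \<bullet> H)) has_real_derivative p t * ?q t / \<epsilon> + ?r t) (at t within {0..T})"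
    if "t \<in> {0..T}" for t
    by (rule DERIV_cong[OF DERIV_mult[OF p[OF that] two_scale_observable[OF sol that]]])
      (simp add: algebra_simps)
  then have "((\<lambda>t. p t * ?q t / \<epsilon> + ?r t) has_integral ?b) {0..T}"
    using T by (intro fundamental_theorem_of_calculus)
      (auto simp: has_real_derivative_iff_has_vector_derivative)
  moreover have r: "?r integrable_on {0..T}"
    by (intro integrable_continuous_interval continuous_intros obs pc p')
  ultimately have "((\<lambda>t. p t * ?q t / \<epsilon> + ?r t - ?r t) has_integral ?b - integral {0..T} ?r) {0..T}"
    by (intro has_integral_diff) (auto simp: integrable_integral)
  then have "((\<lambda>t. \<epsilon> * (p t * ?q t / \<epsilon>)) has_integral \<epsilon> * (?b - integral {0..T} ?r)) {0..T}"
    by (intro has_integral_mult_right) simp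
  then have eq: "integral {0..T} (\<lambda>t. p t * ?q t) = \<epsilon> * (?b - integral {0..T} ?r)"
    using eps by (simp add: integral_unique)
  have B0: "0 \<le> B"
    using B(1)[of 0] T by force
  have end_bound: "\<bar>p t * (\<mu> t \<bullet> H)\<bar> \<le> B * norm H" if "t \<in> {0..T}" for t
    unfolding abs_mult by (intro mult_mono B obs that) (use B0 in auto)
  have "\<bar>?r t\<bar> \<le> B * (norm H + norm (slow_matrix C *v H))" if "t \<in> {0..T}" for t
  proof -
    have "\<bar>p' t * (\<mu> t \<bullet> H)\<bar> \<le> B * norm H" "\<bar>p t * ?c t\<bar> \<le> B * norm (slow_matrix C *v H)"
      unfolding abs_mult by (intro mult_mono B obs that; use B0 in auto)+
    then show ?thesis
      by (simp add: distrib_left)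
  qed
  then have "norm (integral {0..T} ?r) \<le> B * (norm H + norm (slow_matrix C *v H)) * (T - 0)"
    using T by (intro integral_bound continuous_intros obs pc p') auto
  then have "\<bar>?b - integral {0..T} ?r\<bar>
      \<le> B * (2 * norm H + T * (norm H + norm (slow_matrix C *v H)))"
    using end_bound[of 0] end_bound[of T] T by (simp add: algebra_simps)
  then show ?thesis
    using eps by (simp add: eq abs_mult)
qed

text \<open>
  A merely continuous weight has no derivative to integrate by parts with; it is replaced by a
  uniformly close polynomial, at a cost that does not depend on \<open>k\<close>.
\<close>
lemma fast_observable_averages_out:
  fixes \<phi> :: "real \<Rightarrow> real" and m :: "nat \<Rightarrow> real \<Rightarrow> real ^ (2 \<times> 'z::finite)"
  assumes T: "0 \<le> T" and e: "\<And>k. 0 < e k" "e \<longlonglongrightarrow> 0"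
    and curve: "\<And>k. prob_curve T (m k)"
    and sol: "\<And>k. solves_forward T (two_scale_generator Q C (e k)) (m k)"
    and \<phi>: "continuous_on {0..T} \<phi>"
  shows "(\<lambda>k. integral {0..T} (\<lambda>t. \<phi> t * (m k t \<bullet> (fast_matrix Q *v H)))) \<longlonglongrightarrow> 0"
proof (rule tendsto_iff[THEN iffD2], intro allI impI)
  fix \<delta> :: real assume \<delta>: "0 < \<delta>"
  let ?N = "norm (fast_matrix Q *v H)"
  \<comment> \<open>the summand 1 keeps the denominator positive when the fast observable vanishes\<close>
  define \<eta> where "\<eta> = \<delta> / 2 / (1 + T * ?N)"
  have pos: "0 < 1 + T * ?N"
    using T by (smt (verit) mult_nonneg_nonneg norm_ge_zero)
  have \<eta>: "0 < \<eta>"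
    using \<delta> pos by (simp add: \<eta>_def)
  obtain p where p: "real_polynomial_function p" and close: "\<And>t. t \<in> {0..T} \<Longrightarrow> \<bar>\<phi> t - p t\<bar> < \<eta>"
    using Stone_Weierstrass_real_polynomial_function[OF compact_Icc \<phi> \<eta>] by blast
  obtain p' where p': "real_polynomial_function p'" and dp: "\<And>t. (p has_real_derivative p' t) (at t)"
    using has_real_derivative_polynomial_function[OF p] by blast
  have cont: "continuous_on {0..T} p" "continuous_on {0..T} p'"
    using p p' by (auto intro: continuous_on_polymonial_function simp: real_polynomial_function_eq)
  have "bounded (p ` {0..T} \<union> p' ` {0..T})"
    using cont by (intro bounded_Un[THEN iffD2] conjI compact_imp_bounded compact_continuous_image) auto
  then obtain B where B: "\<And>t. t \<in> {0..T} \<Longrightarrow> \<bar>p t\<bar> \<le> B" "\<And>t. t \<in> {0..T} \<Longrightarrow> \<bar>p' t\<bar> \<le> B"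
    unfolding bounded_iff by fastforce
  define K where "K = B * (2 * norm H + T * (norm H + norm (slow_matrix C *v H)))"
  have "(\<lambda>k. e k * K) \<longlonglongrightarrow> 0"
    using tendsto_mult_left_zero[OF e(2)] .
  then have "\<forall>\<^sub>F k in sequentially. e k * K < \<delta> / 2"
    using \<delta> by (intro order_tendstoD) auto
  then show "\<forall>\<^sub>F k in sequentially.
      dist (integral {0..T} (\<lambda>t. \<phi> t * (m k t \<bullet> (fast_matrix Q *v H)))) 0 < \<delta>"
  proof eventually_elim
    case (elim k)
    let ?q = "\<lambda>t. m k t \<bullet> (fast_matrix Q *v H)"
    note obs = prob_curve_observable[OF curve[of k]]
    have "\<bar>(\<phi> t - p t) * ?q t\<bar> \<le> \<eta> * ?N" if "t \<in> {0..T}" for t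
      unfolding abs_mult using close[OF that] \<eta> by (intro mult_mono obs that) auto
    then have "norm (integral {0..T} (\<lambda>t. (\<phi> t - p t) * ?q t)) \<le> \<eta> * ?N * (T - 0)"
      using T by (intro integral_bound continuous_intros obs cont \<phi>) auto
    moreover have "\<eta> * ?N * T \<le> \<delta> / 2"
      using pos \<delta> by (simp add: \<eta>_def field_simps)
    moreover have "\<bar>integral {0..T} (\<lambda>t. p t * ?q t)\<bar> \<le> e k * K"
      unfolding K_def
      by (rule fast_observable_smooth_bound[OF T e(1) curve sol _ cont(2)])
        (use dp B in \<open>auto intro: has_field_derivative_at_within\<close>)
    moreover have "integral {0..T} (\<lambda>t. \<phi> t * ?q t) =
        integral {0..T} (\<lambda>t. (\<phi> t - p t) * ?q t) + integral {0..T} (\<lambda>t. p t * ?q t)"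
      by (subst integral_add[symmetric])
        (auto intro!: integrable_continuous_interval continuous_intros obs cont \<phi>
          simp: left_diff_distrib)
    ultimately show ?case
      using elim by simp
  qed
qed

section \<open>The two-state limit dynamics\<close>

text \<open>
  The explicit solution, started at \<open>p\<close>, of the forward equation of the two-state chain that jumps
  away from \<open>y\<close> at rate \<open>\<kappa> y\<close>: relaxation to the equilibrium \<open>q\<close> at rate \<open>\<Lambda>\<close>.  If both rates
  vanish, division by zero gives \<open>q = 0\<close>, and the formula still yields the correct constant solution.
\<close>
definition two_state_flow :: "(2 \<Rightarrow> real) \<Rightarrow> real ^ 2 \<Rightarrow> real \<Rightarrow> real ^ 2" where
  "two_state_flow \<kappa> p t = (\<chi> y.
     let \<Lambda> = \<kappa> y + \<kappa> (1 - y); q = \<kappa> (1 - y) / \<Lambda> in q + (p $ y - q) * exp (- (\<Lambda> * t)))"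

lemma two_state_flow_0: "two_state_flow \<kappa> p 0 = p"
  by (simp add: two_state_flow_def Let_def vec_eq_iff)

lemma two_state_flow_derivative:
  assumes "\<And>y. 0 \<le> \<kappa> y"
  shows "((\<lambda>t. two_state_flow \<kappa> p t $ y) has_real_derivative
      \<kappa> (1 - y) - (\<kappa> y + \<kappa> (1 - y)) * two_state_flow \<kappa> p t $ y) (at t within S)"
proof -
  define \<Lambda> where "\<Lambda> = \<kappa> y + \<kappa> (1 - y)"
  \<comment> \<open>this makes \<open>\<Lambda> * q = \<kappa> (1 - y)\<close> true also when \<open>q\<close> is a division by zero\<close>
  have "\<kappa> (1 - y) = 0" if "\<Lambda> = 0"
    using assms[of y] assms[of "1 - y"] that by (simp add: \<Lambda>_def)
  then have q: "\<Lambda> * (\<kappa> (1 - y) / \<Lambda>) = \<kappa> (1 - y)"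
    by auto
  have "((\<lambda>t. \<kappa> (1 - y) / \<Lambda> + (p $ y - \<kappa> (1 - y) / \<Lambda>) * exp (- (\<Lambda> * t))) has_real_derivative
      \<Lambda> * (\<kappa> (1 - y) / \<Lambda>) - \<Lambda> * (\<kappa> (1 - y) / \<Lambda> + (p $ y - \<kappa> (1 - y) / \<Lambda>) * exp (- (\<Lambda> * t))))
      (at t within S)"
    by (auto intro!: derivative_eq_intros simp: algebra_simps)
  then show ?thesis
    unfolding q by (simp add: two_state_flow_def Let_def \<Lambda>_def)
qed

lemma two_state_flow_prob:
  assumes rate: "\<And>y. 0 \<le> \<kappa> y" and p: "p \<in> prob_vectors" and t: "0 \<le> t"
  shows "two_state_flow \<kappa> p t \<in> prob_vectors"
proof -
  let ?\<Lambda> = "\<kappa> 0 + \<kappa> 1"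
  have nonneg: "0 \<le> two_state_flow \<kappa> p t $ y" for y
  proof -
    let ?\<Lambda> = "\<kappa> y + \<kappa> (1 - y)"
    have "two_state_flow \<kappa> p t $ y = \<kappa> (1 - y) / ?\<Lambda> * (1 - exp (- (?\<Lambda> * t))) + p $ y * exp (- (?\<Lambda> * t))"
      by (simp add: two_state_flow_def Let_def algebra_simps)
    moreover have "exp (- (?\<Lambda> * t)) \<le> 1"
      using rate t by (simp add: mult_nonneg_nonneg)
    ultimately show ?thesis
      using rate p by (simp add: prob_vectors_def)
  qed
  have p1: "p $ 0 + p $ 1 = 1"
    using p by (simp add: prob_vectors_def sum_two_states[of _ 0])
  define q where "q y = \<kappa> y / ?\<Lambda>" for y :: 2
  define E where "E = exp (- (?\<Lambda> * t))"
  have "two_state_flow \<kappa> p t $ 0 + two_state_flow \<kappa> p t $ 1 =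
      q 1 + (p $ 0 - q 1) * E + (q 0 + (p $ 1 - q 0) * E)"
    by (simp add: two_state_flow_def Let_def q_def E_def add.commute)
  also have "\<dots> = (q 0 + q 1) + (p $ 0 + p $ 1 - (q 0 + q 1)) * E"
    by (simp add: algebra_simps)
  also have "\<dots> = 1"
  proof (cases "?\<Lambda> = 0")
    case True
    then show ?thesis
      using p1 by (simp add: q_def E_def)
  next
    case False
    then have "q 0 + q 1 = 1"
      by (simp add: q_def flip: add_divide_distrib)
    then show ?thesis
      using p1 by simp
  qed
  finally show ?thesis
    using nonneg by (simp add: prob_vectors_def sum_two_states[of _ 0])
qed

lemma inner_limit_generator:
  "v \<bullet> (limit_generator C \<pi> *v g) = (\<Sum>y\<in>UNIV. v $ y * averaged_rate C \<pi> y * (g $ (1 - y) - g $ y))"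
  by (simp add: inner_vec_def limit_generator_mult mult.assoc)

text \<open>
  Since the total mass is one, the forward equation for the mass of a single state closes.
\<close>
lemma inner_limit_generator_axis:
  assumes "v \<in> prob_vectors"
  shows "v \<bullet> (limit_generator C \<pi> *v axis y 1) =
    averaged_rate C \<pi> (1 - y) - (averaged_rate C \<pi> y + averaged_rate C \<pi> (1 - y)) * v $ y"
proof -
  have v: "v $ (1 - y) = 1 - v $ y"
    using assms by (simp add: prob_vectors_def sum_two_states[of _ y])
  have ax: "axis y (1 :: real) $ (1 - y) = 0"
    by (simp add: axis_def)
  show ?thesis
    unfolding inner_limit_generator sum_two_states[of _ y]
    by (simp add: v ax) (simp add: algebra_simps)
qed

lemma averaged_rate_nonneg:
  assumes "\<And>y z z'. 0 \<le> C y (1 - y) $ z $ z'" and "\<And>y. \<pi> y \<in> prob_vectors"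
  shows "0 \<le> averaged_rate C \<pi> y"
  using assms by (auto simp: averaged_rate_def prob_vectors_def intro!: sum_nonneg)

lemma two_state_flow_solves:
  assumes "\<And>y. 0 \<le> averaged_rate C \<pi> y" and "p \<in> prob_vectors"
  shows "solves_forward T (limit_generator C \<pi>) (two_state_flow (averaged_rate C \<pi>) p)"
  unfolding solves_forward_def
proof
  fix t assume t: "t \<in> {0..T}"
  let ?f = "two_state_flow (averaged_rate C \<pi>) p"
  have f: "?f t \<in> prob_vectors"
    using assms t by (intro two_state_flow_prob) auto
  have comp: "(transpose (limit_generator C \<pi>) *v ?f t) $ y =
      averaged_rate C \<pi> (1 - y) - (averaged_rate C \<pi> y + averaged_rate C \<pi> (1 - y)) * ?f t $ y" for y
    using inner_limit_generator_axis[OF f, of C \<pi> y]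
    by (simp add: inner_axis flip: dot_lmul_matrix)
  have "((\<lambda>t. ?f t \<bullet> b) has_vector_derivative (transpose (limit_generator C \<pi>) *v ?f t) \<bullet> b)
      (at t within {0..T})" if b: "b \<in> Basis" for b
  proof -
    obtain y where "b = axis y 1"
      using b by (auto simp: Basis_vec_def)
    then show ?thesis
      using two_state_flow_derivative[of "averaged_rate C \<pi>" p y t "{0..T}", OF assms(1)] comp[of y]
      by (simp add: inner_axis has_real_derivative_iff_has_vector_derivative)
  qed
  then show "(?f has_vector_derivative transpose (limit_generator C \<pi>) *v ?f t) (at t within {0..T})"
    unfolding has_vector_derivative_def by (subst has_derivative_componentwise_within) simp
qed

section \<open>Convergence of the coarse-grained curves\<close>

text \<open>
  Gronwall's argument: with the integrating factor \<open>exp (\<Lambda> s)\<close> the derivative is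
  \<open>exp (\<Lambda> s) * r s\<close>, which is at most \<open>exp (\<Lambda> t) * \<eta>\<close> up to time \<open>t\<close>.
\<close>
lemma damped_ode_bound:
  fixes d :: "real \<Rightarrow> real"
  assumes \<Lambda>: "0 \<le> \<Lambda>" and t: "t \<in> {0..T}"
    and d: "\<And>s. s \<in> {0..T} \<Longrightarrow> (d has_real_derivative r s - \<Lambda> * d s) (at s within {0..T})"
    and r: "\<And>s. s \<in> {0..T} \<Longrightarrow> \<bar>r s\<bar> \<le> \<eta>"
  shows "\<bar>d t\<bar> \<le> \<bar>d 0\<bar> + \<eta> * t"
proof -
  let ?E = "\<lambda>s. exp (\<Lambda> * s) * d s"
  have "norm (?E t - ?E 0) \<le> exp (\<Lambda> * t) * \<eta> * norm (t - 0)"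
  proof (rule field_differentiable_bound[where S = "{0..t}" and f' = "\<lambda>s. exp (\<Lambda> * s) * r s"])
    fix s assume s: "s \<in> {0..t}"
    then have sT: "s \<in> {0..T}"
      using t by auto
    have "(d has_real_derivative r s - \<Lambda> * d s) (at s within {0..t})"
      using t by (intro has_field_derivative_subset[OF d[OF sT]]) auto
    then show "(?E has_field_derivative exp (\<Lambda> * s) * r s) (at s within {0..t})"
      by (auto intro!: derivative_eq_intros simp: algebra_simps)
    show "norm (exp (\<Lambda> * s) * r s) \<le> exp (\<Lambda> * t) * \<eta>"
      using r[OF sT] s \<Lambda> by (auto simp: abs_mult intro!: mult_mono mult_left_mono)
  qed (use t in auto)
  then have diff: "\<bar>?E t - d 0\<bar> \<le> exp (\<Lambda> * t) * (\<eta> * t)"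
    using t by simp
  have "exp (\<Lambda> * t) * \<bar>d t\<bar> = \<bar>?E t\<bar>"
    by (simp add: abs_mult)
  also have "\<dots> \<le> \<bar>d 0\<bar> + exp (\<Lambda> * t) * (\<eta> * t)"
    using diff by linarith
  also have "\<dots> \<le> exp (\<Lambda> * t) * (\<bar>d 0\<bar> + \<eta> * t)"
    using \<Lambda> t mult_right_mono[of 1 "exp (\<Lambda> * t)" "\<bar>d 0\<bar>"] by (simp add: distrib_left)
  finally show ?thesis
    by simp
qed

text \<open>
  The perturbed test function method.  The indicator of the coarse state \<open>y\<close>, pulled back, is
  annihilated by the fast generator, and the slow generator maps it to an observable \<open>G\<close>.  Its
  averaged part drives the limit equation; its fast part \<open>Q H\<close> need not be small at any given time.
  Testing with the indicator minus \<open>\<epsilon> H\<close> cancels that part exactly, so that the corrected mass of \<open>y\<close>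
  solves the limit equation with an error of order \<open>\<epsilon>\<close>.  Since the correction itself is of
  order \<open>\<epsilon>\<close>, the distance to the limit solution exceeds its initial value by at most \<open>\<epsilon> K\<close>, with
  a constant that depends on neither the solution nor \<open>\<epsilon>\<close>.
\<close>
lemma coarse_curve_estimate:
  fixes Q :: "2 \<Rightarrow> real ^ 'z ^ 'z"
  assumes gen: "\<And>y. is_generator (Q y)" and irr: "\<And>y. irreducible_matrix (Q y)"
    and st: "\<And>y. stationary (Q y) (\<pi> y)" and rate: "\<And>y. 0 \<le> averaged_rate C \<pi> y"
  obtains K where "\<And>\<epsilon> \<mu> p t. \<lbrakk>0 < \<epsilon>; prob_curve T \<mu>; solves_forward T (two_scale_generator Q C \<epsilon>) \<mu>;
      p \<in> prob_vectors; t \<in> {0..T}\<rbrakk> \<Longrightarrow>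
      \<bar>push_forward coarse (\<mu> t) $ y - two_state_flow (averaged_rate C \<pi>) p t $ y\<bar>
        \<le> \<bar>push_forward coarse (\<mu> 0) $ y - p $ y\<bar> + \<epsilon> * K"
proof -
  define g :: "real ^ 2" where "g = axis y 1"
  define G where "G = slow_matrix C *v pull_back coarse g"
  define \<Lambda> where "\<Lambda> = averaged_rate C \<pi> y + averaged_rate C \<pi> (1 - y)"
  have \<Lambda>: "0 \<le> \<Lambda>"
    using rate by (simp add: \<Lambda>_def)
  have avg: "local_average \<pi> G = limit_generator C \<pi> *v g"
    unfolding G_def by (rule local_average_slow_matrix)
  \<comment> \<open>the corrector\<close>
  obtain H where "G = pull_back coarse (local_average \<pi> G) + fast_matrix Q *v H"
    by (rule fast_decomposition[OF gen irr st])
  note H = this[unfolded avg]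
  let ?CH = "slow_matrix C *v H"
  define K where "K = 2 * norm H + (\<Lambda> * norm H + norm ?CH) * T"
  show ?thesis
  proof (rule that)
    fix \<epsilon> t :: real and \<mu> :: "real \<Rightarrow> real ^ (2 \<times> 'z)" and p :: "real ^ 2"
    assume \<epsilon>: "0 < \<epsilon>" and curve: "prob_curve T \<mu>"
      and sol: "solves_forward T (two_scale_generator Q C \<epsilon>) \<mu>"
      and p: "p \<in> prob_vectors" and t: "t \<in> {0..T}"
    let ?f = "\<lambda>s. two_state_flow (averaged_rate C \<pi>) p s $ y"
    let ?\<nu> = "\<lambda>s. push_forward coarse (\<mu> s)"
    have \<nu>: "?\<nu> s $ y = \<mu> s \<bullet> pull_back coarse g" for s
      by (simp add: inner_pull_back g_def inner_axis)
    define d where "d s = \<mu> s \<bullet> pull_back coarse g - \<epsilon> * (\<mu> s \<bullet> H) - ?f s" for s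
    define r where "r s = - \<epsilon> * (\<Lambda> * (\<mu> s \<bullet> H) + \<mu> s \<bullet> ?CH)" for s
    have obs: "\<bar>\<mu> s \<bullet> v\<bar> \<le> norm v" if "s \<in> {0..T}" for s v
      using prob_curve_observable(2)[OF curve that] .
    have "\<bar>d t\<bar> \<le> \<bar>d 0\<bar> + \<epsilon> * (\<Lambda> * norm H + norm ?CH) * t"
    proof (rule damped_ode_bound[OF \<Lambda> t])
      fix s assume s: "s \<in> {0..T}"
      have "?\<nu> s \<in> prob_vectors"
        using curve s by (auto simp: prob_curve_def intro!: push_forward_prob_vectors)
      then have "\<mu> s \<bullet> G =
          averaged_rate C \<pi> (1 - y) - \<Lambda> * (\<mu> s \<bullet> pull_back coarse g) + \<mu> s \<bullet> (fast_matrix Q *v H)"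
        using inner_limit_generator_axis[of "?\<nu> s" C \<pi> y]
        by (simp add: H inner_add_right inner_pull_back g_def \<Lambda>_def inner_axis)
      then have eq: "(\<mu> s \<bullet> (fast_matrix Q *v pull_back coarse g) / \<epsilon> + \<mu> s \<bullet> G)
          - \<epsilon> * (\<mu> s \<bullet> (fast_matrix Q *v H) / \<epsilon> + \<mu> s \<bullet> ?CH)
          - (averaged_rate C \<pi> (1 - y) - \<Lambda> * ?f s) = r s - \<Lambda> * d s"
        using \<epsilon> by (simp add: fast_matrix_pull_back[OF gen] r_def d_def algebra_simps)
      show "(d has_real_derivative r s - \<Lambda> * d s) (at s within {0..T})"
        unfolding d_def[abs_def]
        by (rule DERIV_cong[OF _ eq[unfolded d_def]], unfold G_def \<Lambda>_def)
          (intro DERIV_diff DERIV_cmult two_scale_observable[OF sol s]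
            two_state_flow_derivative rate)
      have "\<bar>\<Lambda> * (\<mu> s \<bullet> H) + \<mu> s \<bullet> ?CH\<bar> \<le> \<Lambda> * norm H + norm ?CH"
        using mult_left_mono[OF obs[OF s, of H] \<Lambda>] obs[OF s, of ?CH] \<Lambda>
        by (intro order_trans[OF abs_triangle_ineq]) (simp add: abs_mult)
      then show "\<bar>r s\<bar> \<le> \<epsilon> * (\<Lambda> * norm H + norm ?CH)"
        using \<epsilon> by (simp add: r_def abs_mult)
    qed
    moreover have "\<epsilon> * (\<Lambda> * norm H + norm ?CH) * t \<le> \<epsilon> * (\<Lambda> * norm H + norm ?CH) * T"
      using t \<epsilon> \<Lambda> by (intro mult_left_mono) auto
    moreover have "\<bar>\<epsilon> * (\<mu> s \<bullet> H)\<bar> \<le> \<epsilon> * norm H" if "s \<in> {0..T}" for s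
      using obs[OF that, of H] \<epsilon> by (simp add: abs_mult)
    from this[OF t] this[of 0] have "\<bar>?\<nu> t $ y - ?f t\<bar> \<le> \<bar>d t\<bar> + \<epsilon> * norm H"
      "\<bar>d 0\<bar> \<le> \<bar>?\<nu> 0 $ y - p $ y\<bar> + \<epsilon> * norm H"
      using t unfolding \<nu> d_def two_state_flow_0 by auto
    moreover have "\<epsilon> * K = 2 * (\<epsilon> * norm H) + \<epsilon> * (\<Lambda> * norm H + norm ?CH) * T"
      by (simp add: K_def algebra_simps)
    ultimately show "\<bar>?\<nu> t $ y - ?f t\<bar> \<le> \<bar>?\<nu> 0 $ y - p $ y\<bar> + \<epsilon> * K"
      by linarith
  qed
qed

text \<open>
  Because the limit equation determines its solution from the initial value, convergence of the
  initial values alone forces uniform convergence of the whole curves.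
\<close>
lemma coarse_convergence:
  fixes m :: "nat \<Rightarrow> real \<Rightarrow> real ^ (2 \<times> 'z::finite)"
  assumes gen: "\<And>y. is_generator (Q y)" and irr: "\<And>y. irreducible_matrix (Q y)"
    and st: "\<And>y. stationary (Q y) (\<pi> y)" and rate: "\<And>y. 0 \<le> averaged_rate C \<pi> y"
    and e: "\<And>k. 0 < e k" "e \<longlonglongrightarrow> 0"
    and curve: "\<And>k. prob_curve T (m k)"
    and sol: "\<And>k. solves_forward T (two_scale_generator Q C (e k)) (m k)"
    and p: "p \<in> prob_vectors"
    and init: "(\<lambda>k. push_forward coarse (m k 0)) \<longlonglongrightarrow> p"
  shows "uniform_limit {0..T} (\<lambda>k t. push_forward coarse (m k t))
    (two_state_flow (averaged_rate C \<pi>) p) sequentially"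
proof -
  let ?f = "two_state_flow (averaged_rate C \<pi>) p"
  have "\<exists>K. \<forall>k t. t \<in> {0..T} \<longrightarrow> \<bar>push_forward coarse (m k t) $ y - ?f t $ y\<bar>
      \<le> \<bar>push_forward coarse (m k 0) $ y - p $ y\<bar> + e k * K" for y
    using coarse_curve_estimate[OF gen irr st rate, where y = y and T = T]
      e(1) curve sol p by metis
  then obtain K where K: "\<And>y k t. t \<in> {0..T} \<Longrightarrow> \<bar>push_forward coarse (m k t) $ y - ?f t $ y\<bar>
      \<le> \<bar>push_forward coarse (m k 0) $ y - p $ y\<bar> + e k * K y"
    by metis
  define b where "b k = (\<Sum>y\<in>UNIV. \<bar>push_forward coarse (m k 0) $ y - p $ y\<bar> + e k * K y)" for k
  have "(\<lambda>k. \<bar>push_forward coarse (m k 0) $ y - p $ y\<bar> + e k * K y) \<longlonglongrightarrow> \<bar>p $ y - p $ y\<bar> + 0 * K y" for y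
    by (intro tendsto_intros init e)
  then have b: "b \<longlonglongrightarrow> 0"
    unfolding b_def[abs_def] by (intro tendsto_null_sum) simp
  have bound: "dist (push_forward coarse (m k t)) (?f t) \<le> b k" if "t \<in> {0..T}" for k t
    unfolding dist_norm b_def
    by (rule order_trans[OF norm_le_l1_cart]) (use K[OF that] in \<open>auto intro: sum_mono\<close>)
  show ?thesis
  proof (rule uniform_limitI)
    fix \<delta> :: real assume "0 < \<delta>"
    with b have "\<forall>\<^sub>F k in sequentially. b k < \<delta>"
      by (rule order_tendstoD)
    then show "\<forall>\<^sub>F k in sequentially. \<forall>t\<in>{0..T}. dist (push_forward coarse (m k t)) (?f t) < \<delta>"
    proof eventually_elim
      case (elim k)
      show ?case
        using le_less_trans[OF bound elim] by blast
    qed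
  qed
qed

section \<open>Measures on time-space induced by curves\<close>

lemma finite_measure_time_space:
  fixes T :: real
  shows
  "finite_measure (restrict_space lborel {0..T} \<Otimes>\<^sub>M count_space (UNIV :: 'x::finite set))"
proof (rule finite_measure_pair_measure)
  show "finite_measure (restrict_space lborel {0..T})"
  proof (rule finite_measureI)
    have "emeasure (restrict_space lborel {0..T}) {0..T} = emeasure lborel {0..T}"
      by (rule emeasure_restrict_space) auto
    then show "emeasure (restrict_space lborel {0..T}) (space (restrict_space lborel {0..T})) \<noteq> \<infinity>"
      by (simp add: space_restrict_space emeasure_lborel_Icc_eq)
  qed
qed (auto intro: finite_measure_count_space)

lemma measurable_time_space:
  fixes f :: "real \<times> 'x::finite \<Rightarrow> real"
  assumes "\<And>x. (\<lambda>t. f (t, x)) \<in> borel_measurable (restrict_space lborel {0..T})"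
  shows "f \<in> borel_measurable (restrict_space lborel {0..T} \<Otimes>\<^sub>M count_space UNIV)"
proof -
  have "(\<lambda>(x, t). f (t, x)) \<in> borel_measurable (count_space UNIV \<Otimes>\<^sub>M restrict_space lborel {0..T})"
    using assms by (intro measurable_pair_measure_countable1) auto
  from measurable_pair_swap[OF this] show ?thesis
    by (simp add: case_prod_beta')
qed

lemma continuous_measurable_time:
  fixes f :: "real \<Rightarrow> real"
  assumes "continuous_on {0..T} f"
  shows "f \<in> borel_measurable (restrict_space lborel {0..T})"
proof -
  have "f \<in> borel_measurable (restrict_space borel {0..T})"
    using assms by (rule borel_measurable_continuous_on_restrict)
  then show ?thesis
    by (simp cong: measurable_cong_sets add: sets_restrict_space_cong[of lborel borel])
qed

text \<open>
  The components are continuous densities bounded by one, which makes all integrals over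
  time-space below finite.
\<close>
lemma prob_curve_component:
  assumes "prob_curve T \<mu>"
  shows "continuous_on {0..T} (\<lambda>t. \<mu> t $ x)"
    and "t \<in> {0..T} \<Longrightarrow> 0 \<le> \<mu> t $ x"
    and "t \<in> {0..T} \<Longrightarrow> \<mu> t $ x \<le> 1"
proof -
  show "continuous_on {0..T} (\<lambda>t. \<mu> t $ x)"
    using assms by (auto simp: prob_curve_def intro!: continuous_intros)
  assume t: "t \<in> {0..T}"
  then show "0 \<le> \<mu> t $ x"
    using assms by (auto simp: prob_curve_def prob_vectors_def image_subset_iff)
  show "\<mu> t $ x \<le> 1"
    using prob_curve_observable(2)[OF assms t, of "axis x 1"] by (simp add: inner_axis)
qed

lemma prob_curve_borel_family:
  assumes "prob_curve T \<mu>"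
  shows "borel_family T \<mu>"
  using assms borel_measurable_continuous_on_restrict by (auto simp: borel_family_def prob_curve_def)

lemma curve_measure_time_space_measures:
  fixes \<mu> :: "real \<Rightarrow> real ^ 'x"
  assumes \<mu>: "prob_curve T \<mu>"
  shows "curve_measure T \<mu> \<in> time_space_measures T"
proof -
  let ?N = "restrict_space lborel {0..T} \<Otimes>\<^sub>M count_space (UNIV :: 'x set)"
  let ?f = "\<lambda>(t, x). ennreal (\<mu> t $ x)"
  have f: "?f \<in> borel_measurable ?N"
    using measurable_time_space[of "\<lambda>(t, x). \<mu> t $ x" T] continuous_measurable_time prob_curve_component(1)[OF \<mu>]
    by (simp add: case_prod_beta')
  have "emeasure (curve_measure T \<mu>) (space ?N) = (\<integral>\<^sup>+ z. ?f z * indicator (space ?N) z \<partial>?N)"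
    unfolding curve_measure_def by (intro emeasure_density f) auto
  also have "\<dots> \<le> (\<integral>\<^sup>+ z. 1 \<partial>?N)"
    using prob_curve_component(3)[OF \<mu>]
    by (intro nn_integral_mono) (auto simp: space_pair_measure space_restrict_space ennreal_le_1)
  also have "\<dots> < \<infinity>"
    using finite_measure.finite_emeasure_space[OF finite_measure_time_space[of T, where 'x = 'x]]
    by (simp add: top.not_eq_extremum)
  finally have "finite_measure (curve_measure T \<mu>)"
    by (intro finite_measureI) (simp add: curve_measure_def)
  moreover have "sets (curve_measure T \<mu>) = sets (restrict_space borel {0..T} \<Otimes>\<^sub>M count_space UNIV)"
    by (simp add: curve_measure_def) (intro sets_pair_measure_cong sets_restrict_space_cong; simp)
  ultimately show ?thesis
    by (simp add: time_space_measures_def)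
qed

lemma test_function_section:
  assumes "continuous_map (prod_topology (top_of_set {0..T}) (discrete_topology UNIV)) euclideanreal \<phi>"
  shows "continuous_on {0..T} (\<lambda>t. \<phi> (t, x))"
proof -
  have "continuous_map (top_of_set {0..T}) (prod_topology (top_of_set {0..T}) (discrete_topology UNIV))
      (\<lambda>t. (t, x))"
    by (simp add: continuous_map_paired)
  from continuous_map_compose[OF this assms] show ?thesis
    by (simp add: o_def)
qed

text \<open>
  Fubini reduces an integral over time-space to finitely many integrals of continuous functions over
  the time interval, which is the form in which averaging applies.
\<close>
lemma integral_curve_measure:
  fixes \<mu> :: "real \<Rightarrow> real ^ 'x" and \<phi> :: "real \<times> 'x \<Rightarrow> real"
  assumes \<mu>: "prob_curve T \<mu>" and \<phi>: "\<And>x. continuous_on {0..T} (\<lambda>t. \<phi> (t, x))"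
  shows "integral\<^sup>L (curve_measure T \<mu>) \<phi> = (\<Sum>x\<in>UNIV. integral {0..T} (\<lambda>t. \<phi> (t, x) * \<mu> t $ x))"
proof -
  let ?R = "restrict_space lborel {0..T}"
  let ?N = "?R \<Otimes>\<^sub>M count_space (UNIV :: 'x set)"
  let ?f = "\<lambda>(t, x). \<phi> (t, x) * \<mu> t $ x"
  note comp = prob_curve_component[OF \<mu>]
  have prod: "continuous_on {0..T} (\<lambda>t. \<phi> (t, x) * \<mu> t $ x)" for x
    by (intro continuous_intros \<phi> comp)
  interpret N: finite_measure ?N
    by (rule finite_measure_time_space)
  interpret R: sigma_finite_measure ?R
    by (intro sigma_finite_measure_restrict_space sigma_finite_lborel) auto
  interpret Z: sigma_finite_measure "count_space (UNIV :: 'x set)"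
    by (rule sigma_finite_measure_count_space_finite) simp
  interpret P: pair_sigma_finite ?R "count_space (UNIV :: 'x set)" ..
  have m\<phi>: "\<phi> \<in> borel_measurable ?N"
    by (intro measurable_time_space continuous_measurable_time \<phi>)
  have m\<mu>: "(\<lambda>(t, x). \<mu> t $ x) \<in> borel_measurable ?N"
    using comp(1) by (intro measurable_time_space) (auto intro: continuous_measurable_time)
  have mf: "?f \<in> borel_measurable ?N"
    using prod by (intro measurable_time_space) (auto intro: continuous_measurable_time)
  have "bounded (\<Union>x. (\<lambda>t. \<phi> (t, x) * \<mu> t $ x) ` {0..T})"
    by (intro bounded_UN ballI compact_imp_bounded compact_continuous_image prod) auto
  then obtain B where B: "\<And>t x. t \<in> {0..T} \<Longrightarrow> \<bar>\<phi> (t, x) * \<mu> t $ x\<bar> \<le> B"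
    unfolding bounded_iff by fastforce
  have int: "integrable ?N ?f"
    using B by (intro N.integrable_const_bound[where B = B] mf AE_I2)
      (auto simp: space_pair_measure space_restrict_space)
  have lebesgue_eq: "(\<integral>t. \<phi> (t, x) * \<mu> t $ x \<partial>?R) = integral {0..T} (\<lambda>t. \<phi> (t, x) * \<mu> t $ x)" for x
  proof -
    have "set_integrable lborel {0..T} (\<lambda>t. \<phi> (t, x) * \<mu> t $ x)"
      using prod by (intro borel_integrable_compact[folded set_integrable_def]) (auto simp: set_integrable_def)
    then show ?thesis
      by (subst integral_restrict_space)
        (auto simp: set_borel_integral_eq_integral(2)[symmetric] set_lebesgue_integral_def)
  qed
  have "integral\<^sup>L (curve_measure T \<mu>) \<phi> = integral\<^sup>L (density ?N (\<lambda>z. ennreal (case z of (t, x) \<Rightarrow> \<mu> t $ x))) \<phi>"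
    by (simp add: curve_measure_def case_prod_beta')
  also have "\<dots> = integral\<^sup>L ?N (\<lambda>z. (case z of (t, x) \<Rightarrow> \<mu> t $ x) *\<^sub>R \<phi> z)"
    using comp(2) by (intro integral_density m\<phi> m\<mu> AE_I2) (auto simp: space_pair_measure space_restrict_space)
  also have "\<dots> = integral\<^sup>L ?N ?f"
    by (intro arg_cong[where f = "integral\<^sup>L ?N"]) (auto simp: fun_eq_iff)
  also have "\<dots> = (\<integral>x. (\<integral>t. \<phi> (t, x) * \<mu> t $ x \<partial>?R) \<partial>count_space UNIV)"
    by (rule P.integral_snd[symmetric]) (rule int)
  also have "\<dots> = (\<Sum>x\<in>UNIV. \<integral>t. \<phi> (t, x) * \<mu> t $ x \<partial>?R)"
    by (rule lebesgue_integral_count_space_finite) simp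
  also have "\<dots> = (\<Sum>x\<in>UNIV. integral {0..T} (\<lambda>t. \<phi> (t, x) * \<mu> t $ x))"
    by (simp add: lebesgue_eq)
  finally show ?thesis .
qed

section \<open>Local equilibrium\<close>

text \<open>
  The measure on the fine state space that has coarse marginal \<open>m\<close> and is in equilibrium on
  each fibre.
\<close>
definition local_equilibrium :: "(2 \<Rightarrow> real ^ 'z) \<Rightarrow> real ^ 2 \<Rightarrow> real ^ (2 \<times> 'z)" where
  "local_equilibrium \<pi> m = (\<chi> x. m $ fst x * \<pi> (fst x) $ snd x)"

lemma mass_local_equilibrium:
  "mass (local_equilibrium \<pi> m) ({y} \<times> A) = m $ y * mass (\<pi> y) A"
proof -
  have "mass (local_equilibrium \<pi> m) ({y} \<times> A) = (\<Sum>x\<in>Pair y ` A. m $ fst x * \<pi> (fst x) $ snd x)"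
    by (auto simp: mass_def local_equilibrium_def intro!: sum.cong)
  also have "\<dots> = m $ y * mass (\<pi> y) A"
    by (subst sum.reindex) (auto simp: inj_on_def mass_def sum_distrib_left)
  finally show ?thesis .
qed

lemma push_forward_local_equilibrium:
  assumes "\<And>y. \<pi> y \<in> prob_vectors"
  shows "push_forward coarse (local_equilibrium \<pi> m) = m"
proof -
  have coarse: "coarse -` {y} = {y} \<times> (UNIV :: 'z::finite set)" for y
    by (auto simp: coarse_def)
  have "mass (\<pi> y) UNIV = 1" for y
    using assms by (simp add: mass_def prob_vectors_def)
  then show ?thesis
    by (simp add: push_forward_def vec_eq_iff coarse mass_local_equilibrium)
qed

lemma prob_curve_local_equilibrium:
  assumes \<pi>: "\<And>y. \<pi> y \<in> prob_vectors" and m: "prob_curve T m"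
  shows "prob_curve T (\<lambda>t. local_equilibrium \<pi> (m t))"
proof -
  have "local_equilibrium \<pi> (m t) \<in> prob_vectors" if "t \<in> {0..T}" for t
  proof -
    have mt: "m t \<in> prob_vectors"
      using m that by (auto simp: prob_curve_def)
    have "(\<Sum>x\<in>UNIV. local_equilibrium \<pi> (m t) $ x) = (\<Sum>y\<in>UNIV. m t $ y * (\<Sum>z\<in>UNIV. \<pi> y $ z))"
      by (simp add: sum_two_blocks local_equilibrium_def sum_distrib_left)
    then show ?thesis
      using \<pi> mt by (simp add: prob_vectors_def local_equilibrium_def)
  qed
  moreover have "continuous_on {0..T} (\<lambda>t. local_equilibrium \<pi> (m t))"
    unfolding local_equilibrium_def using m
    by (intro continuous_on_vec_lambda continuous_intros) (auto simp: prob_curve_def)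
  ultimately show ?thesis
    by (auto simp: prob_curve_def)
qed

section \<open>Narrow convergence to local equilibrium\<close>

lemma inner_local_equilibrium: "local_equilibrium \<pi> m \<bullet> G = m \<bullet> local_average \<pi> G"
  by (simp add: inner_vec_def sum_two_blocks local_equilibrium_def local_average_def fibre_def
      sum_distrib_left mult.assoc)

text \<open>
  It suffices to follow the mass of a single state \<open>x\<close>.  By the decomposition of its indicator, this
  mass is a linear function of the coarse-grained curve, which converges uniformly, plus a fast
  observable, whose time averages vanish.
\<close>
lemma narrow_convergence_to_local_equilibrium:
  fixes m :: "nat \<Rightarrow> real \<Rightarrow> real ^ (2 \<times> 'z::finite)"
  assumes T: "0 \<le> T" and e: "\<And>k. 0 < e k" "e \<longlonglongrightarrow> 0"
    and gen: "\<And>y. is_generator (Q y)" and irr: "\<And>y. irreducible_matrix (Q y)"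
    and st: "\<And>y. stationary (Q y) (\<pi> y)"
    and curve: "\<And>k. prob_curve T (m k)"
    and sol: "\<And>k. solves_forward T (two_scale_generator Q C (e k)) (m k)"
    and v: "prob_curve T v"
    and lim: "uniform_limit {0..T} (\<lambda>k t. push_forward coarse (m k t)) v sequentially"
  shows "narrowly_converges T (\<lambda>k. curve_measure T (m k)) (curve_measure T (\<lambda>t. local_equilibrium \<pi> (v t)))"
  unfolding narrowly_converges_def
proof (intro allI impI, elim conjE)
  fix \<phi> :: "real \<times> (2 \<times> 'z) \<Rightarrow> real"
  assume "continuous_map (prod_topology (top_of_set {0..T}) (discrete_topology UNIV)) euclideanreal \<phi>"
  note \<phi> = test_function_section[OF this]
  have \<pi>: "\<pi> y \<in> prob_vectors" for y
    using st by (simp add: stationary_def)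
  have "(\<lambda>k. integral {0..T} (\<lambda>t. \<phi> (t, x) * m k t $ x))
      \<longlonglongrightarrow> integral {0..T} (\<lambda>t. \<phi> (t, x) * local_equilibrium \<pi> (v t) $ x)" for x
  proof -
    let ?a = "local_average \<pi> (axis x 1)"
    obtain H where H: "axis x 1 = pull_back coarse ?a + fast_matrix Q *v H"
      by (rule fast_decomposition[OF gen irr st])
    have split: "m k t $ x = push_forward coarse (m k t) \<bullet> ?a + m k t \<bullet> (fast_matrix Q *v H)" for k t
      using arg_cong[OF H, of "\<lambda>u. m k t \<bullet> u"] by (simp add: inner_add_right inner_pull_back inner_axis)
    have limit: "local_equilibrium \<pi> (v t) $ x = v t \<bullet> ?a" for t
      using inner_local_equilibrium[of \<pi> "v t" "axis x 1"] by (simp add: inner_axis)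
    have cont: "continuous_on {0..T} (\<lambda>t. \<phi> (t, x) * (push_forward coarse (m k t) \<bullet> ?a))" for k
      unfolding inner_pull_back[symmetric]
      by (intro continuous_intros \<phi> prob_curve_observable(1)[OF curve])
    have unif: "uniform_limit {0..T} (\<lambda>k t. \<phi> (t, x) * (push_forward coarse (m k t) \<bullet> ?a))
        (\<lambda>t. \<phi> (t, x) * (v t \<bullet> ?a)) sequentially"
    proof (rule uniform_lim_mult)
      show "uniform_limit {0..T} (\<lambda>k t. push_forward coarse (m k t) \<bullet> ?a) (\<lambda>t. v t \<bullet> ?a) sequentially"
        by (rule bounded_linear.uniform_limit[OF bounded_linear_inner_left lim])
      show "bounded ((\<lambda>t. \<phi> (t, x)) ` {0..T})"
        by (intro compact_imp_bounded compact_continuous_image \<phi>) auto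
      show "bounded ((\<lambda>t. v t \<bullet> ?a) ` {0..T})"
        by (intro compact_imp_bounded compact_continuous_image prob_curve_observable(1)[OF v]) auto
    qed (rule uniform_limit_const)
    obtain I J
      where I: "\<And>k. ((\<lambda>t. \<phi> (t, x) * (push_forward coarse (m k t) \<bullet> ?a)) has_integral I k) {0..T}"
        and J: "((\<lambda>t. \<phi> (t, x) * (v t \<bullet> ?a)) has_integral J) {0..T}" and "I \<longlonglongrightarrow> J"
      by (rule uniform_limit_integral[OF unif cont sequentially_bot]) (rule that)
    then have "(\<lambda>k. integral {0..T} (\<lambda>t. \<phi> (t, x) * (push_forward coarse (m k t) \<bullet> ?a)))
        \<longlonglongrightarrow> integral {0..T} (\<lambda>t. \<phi> (t, x) * (v t \<bullet> ?a))"
      by (simp add: integral_unique[OF I] integral_unique[OF J])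
    from tendsto_add[OF this fast_observable_averages_out[OF T e curve sol \<phi>[of x], of H]]
    have "(\<lambda>k. integral {0..T} (\<lambda>t. \<phi> (t, x) * (push_forward coarse (m k t) \<bullet> ?a))
          + integral {0..T} (\<lambda>t. \<phi> (t, x) * (m k t \<bullet> (fast_matrix Q *v H))))
        \<longlonglongrightarrow> integral {0..T} (\<lambda>t. \<phi> (t, x) * (v t \<bullet> ?a))"
      by simp
    moreover have "integral {0..T} (\<lambda>t. \<phi> (t, x) * m k t $ x) =
        integral {0..T} (\<lambda>t. \<phi> (t, x) * (push_forward coarse (m k t) \<bullet> ?a))
          + integral {0..T} (\<lambda>t. \<phi> (t, x) * (m k t \<bullet> (fast_matrix Q *v H)))" for k
      unfolding split distrib_left
      by (intro integral_add integrable_continuous_interval cont continuous_intros \<phi>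
          prob_curve_observable(1)[OF curve])
    ultimately show ?thesis
      by (simp add: limit)
  qed
  then show "(\<lambda>k. integral\<^sup>L (curve_measure T (m k)) \<phi>)
      \<longlonglongrightarrow> integral\<^sup>L (curve_measure T (\<lambda>t. local_equilibrium \<pi> (v t))) \<phi>"
    by (simp add: integral_curve_measure[OF curve \<phi>]
        integral_curve_measure[OF prob_curve_local_equilibrium[OF \<pi> v] \<phi>] tendsto_sum)
qed

section \<open>Averaging of the two-scale dynamics\<close>

theorem theorem1p7:
  fixes T :: real
    and Q :: "2 \<Rightarrow> real ^ 'z ^ 'z"
    and C :: "2 \<Rightarrow> 2 \<Rightarrow> real ^ 'z ^ 'z"
    and \<pi>\<epsilon> :: "real \<Rightarrow> real ^ (2 \<times> 'z)"
    and \<pi> :: "2 \<Rightarrow> real ^ 'z"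
    and \<mu>\<epsilon> :: "real \<Rightarrow> real \<Rightarrow> real ^ (2 \<times> 'z)"
    and \<mu>\<epsilon>0 :: "real \<Rightarrow> real ^ (2 \<times> 'z)"
    and eps :: "nat \<Rightarrow> real"
  assumes "T > 0"
    and "\<And>y. is_generator (Q y)"
    and "\<And>y. irreducible_matrix (Q y)"
    and "\<And>y z z'. 0 \<le> C y (1 - y) $ z $ z'"
    and "\<And>\<epsilon>. \<epsilon> > 0 \<Longrightarrow> irreducible_matrix (two_scale_generator Q C \<epsilon>)"
    and "\<And>\<epsilon>. \<epsilon> > 0 \<Longrightarrow> stationary (two_scale_generator Q C \<epsilon>) (\<pi>\<epsilon> \<epsilon>)"
    and "\<And>y. stationary (Q y) (\<pi> y)"
    and "\<And>\<epsilon>. \<epsilon> > 0 \<Longrightarrow> \<mu>\<epsilon>0 \<epsilon> \<in> prob_vectors"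
    and "\<And>\<epsilon>. \<epsilon> > 0 \<Longrightarrow> prob_curve T (\<mu>\<epsilon> \<epsilon>)"
    and "\<And>\<epsilon>. \<epsilon> > 0 \<Longrightarrow> solves_forward T (two_scale_generator Q C \<epsilon>) (\<mu>\<epsilon> \<epsilon>)"
    and "\<And>\<epsilon>. \<epsilon> > 0 \<Longrightarrow> \<mu>\<epsilon> \<epsilon> 0 = \<mu>\<epsilon>0 \<epsilon>"
    and "(SUP \<epsilon>\<in>{0<..}. relative_entropy (\<mu>\<epsilon>0 \<epsilon>) (\<pi>\<epsilon> \<epsilon>)) < \<infinity>"
    and "\<And>k. eps k > 0" and "eps \<longlonglongrightarrow> 0"
  shows "\<exists>(r :: nat \<Rightarrow> nat) (M :: (real \<times> (2 \<times> 'z)) measure)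
           (\<mu> :: real \<Rightarrow> real ^ (2 \<times> 'z)) (\<mu>hat :: real \<Rightarrow> real ^ 2).
     strict_mono r \<and>
     \<comment> \<open>compactness\<close>
     M \<in> time_space_measures T \<and> borel_family T \<mu> \<and> M = curve_measure T \<mu> \<and>
     narrowly_converges T (\<lambda>k. curve_measure T (\<mu>\<epsilon> (eps (r k)))) M \<and>
     prob_curve T (\<lambda>t. push_forward coarse (\<mu> t)) \<and>
     uniform_limit {0..T} (\<lambda>k t. push_forward coarse (\<mu>\<epsilon> (eps (r k)) t))
       (\<lambda>t. push_forward coarse (\<mu> t)) sequentially \<and>
     \<comment> \<open>local equilibrium\<close>
     prob_curve T \<mu>hat \<and>
     (AE t\<in>{0..T} in lborel. \<forall>y A. mass (\<mu> t) ({y} \<times> A) = \<mu>hat t $ y * mass (\<pi> y) A) \<and>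
     uniform_limit {0..T} (\<lambda>k t. push_forward coarse (\<mu>\<epsilon> (eps (r k)) t)) \<mu>hat sequentially \<and>
     \<comment> \<open>limit dynamics\<close>
     solves_forward T (limit_generator C \<pi>) \<mu>hat"
proof -
  note gen = assms(2) and irr = assms(3) and st = assms(7)
  have \<pi>: "\<pi> y \<in> prob_vectors" for y
    using st by (simp add: stationary_def)
  have rate: "0 \<le> averaged_rate C \<pi> y" for y
    using assms(4) \<pi> by (rule averaged_rate_nonneg)
  have "push_forward coarse (\<mu>\<epsilon> (eps k) 0) \<in> prob_vectors" for k
    using assms(8)[OF assms(13)] assms(11)[OF assms(13)] by (simp add: push_forward_prob_vectors)
  \<comment> \<open>a subsequence is needed only to make the coarse-grained initial values converge\<close>
  then obtain p r where p: "p \<in> prob_vectors" and r: "strict_mono (r :: nat \<Rightarrow> nat)"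
    and init: "(\<lambda>k. push_forward coarse (\<mu>\<epsilon> (eps (r k)) 0)) \<longlonglongrightarrow> p"
    using seq_compactE[OF compact_imp_seq_compact[OF compact_prob_vectors],
        of "\<lambda>k. push_forward coarse (\<mu>\<epsilon> (eps k) 0)"]
    by (auto simp: o_def)
  let ?m = "\<lambda>k. \<mu>\<epsilon> (eps (r k))"
  let ?v = "two_state_flow (averaged_rate C \<pi>) p"
  let ?\<mu> = "\<lambda>t. local_equilibrium \<pi> (?v t)"
  have T: "0 \<le> T"
    using assms(1) by simp
  have e: "0 < eps (r k)" for k
    by (rule assms(13))
  have e0: "(\<lambda>k. eps (r k)) \<longlonglongrightarrow> 0"
    using LIMSEQ_subseq_LIMSEQ[OF assms(14) r] by (simp add: o_def)
  have curve: "prob_curve T (?m k)"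
    and sol: "solves_forward T (two_scale_generator Q C (eps (r k))) (?m k)" for k
    using assms(9,10) e by auto
  have unif: "uniform_limit {0..T} (\<lambda>k t. push_forward coarse (?m k t)) ?v sequentially"
    by (rule coarse_convergence[where Q = Q and \<pi> = \<pi> and C = C and m = ?m
          and e = "\<lambda>k. eps (r k)", OF gen irr st rate e e0 curve sol p init])
  have vsol: "solves_forward T (limit_generator C \<pi>) ?v"
    by (rule two_state_flow_solves[OF rate p])
  have "continuous_on {0..T} ?v"
    using vsol has_vector_derivative_continuous
    unfolding solves_forward_def continuous_on_eq_continuous_within by blast
  then have v: "prob_curve T ?v"
    using two_state_flow_prob[OF rate p] by (auto simp: prob_curve_def)
  note \<mu> = prob_curve_local_equilibrium[OF \<pi> v]
  show ?thesis
  proof (intro exI conjI)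
    show "strict_mono r"
      by (rule r)
    show "curve_measure T ?\<mu> \<in> time_space_measures T"
      using \<mu> by (rule curve_measure_time_space_measures)
    show "borel_family T ?\<mu>"
      using \<mu> by (rule prob_curve_borel_family)
    show "narrowly_converges T (\<lambda>k. curve_measure T (?m k)) (curve_measure T ?\<mu>)"
      by (rule narrow_convergence_to_local_equilibrium[where Q = Q and \<pi> = \<pi> and C = C and m = ?m
          and e = "\<lambda>k. eps (r k)", OF T e e0 gen irr st curve sol v unif])
    show "AE t\<in>{0..T} in lborel. \<forall>y A. mass (?\<mu> t) ({y} \<times> A) = ?v t $ y * mass (\<pi> y) A"
      by (simp add: mass_local_equilibrium)
  qed (use v unif vsol in \<open>simp_all add: push_forward_local_equilibrium[OF \<pi>]\<close>)
qed

end
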